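(* Let $*:\hat S\to\widehat{{}^*S}$ be an enlargement, and let $\mathcal T$ and $\mathcal T'$ be $\hat S$-small triangulated categories. If $F:\mathcal T\to\mathcal T'$ is a functor of triangulated categories, then ${}^*F:{}^*\mathcal T\to{}^*\mathcal T'$ is also a functor of triangulated categories.
   Context: Superstructures: a base set $S$ is an infinite set whose elements are not sets; $S_0=S$, $S_n=S_{n-1}\cup\mathcal P(S_{n-1})$, and $\hat S=\bigcup_{n\ge 0}S_n$. Formulas in $\hat S$ are built from $=$, $\in$, constants in $\hat S$, variables, ordered pairs and function application by $\neg$, $\wedge$ and bounded quantifiers $\forall x\in t$; statements are formulas without free variables. For $\varphi$ a formula in $\hat S$, ${}^*\varphi$ is obtained by replacing each constant $\tau$ by ${}^*\tau$. Enlargement: a map $*:\hat S\to\hat W$ between superstructures with (1) ${}^*S=W$; (2) ${}^*s=s$ for $s\in S$; (3) (transfer) a statement $\varphi$ in $\hat S$ is true iff ${}^*\varphi$ is true; (4) (saturation) with $\mathcal I=\bigcup_{A\in\hat S\setminus S}{}^*A$ (the internal elements), every nonempty family $\{U_i\}_{i\in I}$ of nonempty sets $U_i\in\mathcal I$ with $|I|\le|\hat S|$ and the finite intersection property has nonempty intersection. $\hat S$-small category: a category $\mathcal T=\langle M,s,t,c\rangle$ given by its set of morphisms $M\in\hat S\setminus S$, the maps $s,t:M\to M$ sending a morphism to the identity of its source resp. target, and the composition relation $c$; objects are identified with their identity morphisms. Its enlargement is ${}^*\mathcal T=\langle{}^*M,{}^*s,{}^*t,{}^*c\rangle$ (with ${}^*P$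 as addition of morphisms if $P\subseteq M^3$ records addition in an additive $\mathcal T$). A functor $F$ (a map on morphism sets) has an enlargement ${}^*F$, a functor between the enlarged categories. An $\hat S$-small triangulated category is a triple $(\mathcal T,\Sigma,\Delta)$ with $\mathcal T$ an additive $\hat S$-small category, $\Sigma$ an automorphism of $\mathcal T$ and $\Delta$ a set of triangles satisfying the usual axioms; its enlargement is the triangulated category $({}^*\mathcal T,{}^*\Sigma,{}^*\Delta)$. A functor of triangulated categories is an additive functor compatible with the automorphisms $\Sigma$ and mapping triangles in $\Delta$ to triangles in $\Delta'$, in the usual sense. *)

theory Defs
  imports "HOL-Library.Equipollence" "HOL-Algebra.Group"
begin

section \<open>The ambient set-theoretic universe\<close>

text \<open>
  A superstructure over an infinite base set has rank \<open>\<omega>\<close> and cannot be built as a HOL type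
  over its base. The ambient universe is therefore a type variable of the following class: a model
  of Zermelo set theory with urelements. Foundation, infinity and replacement are not needed.
  Separation is stated for arbitrary HOL sets, so power sets are full power sets and each
  superstructure below is the genuine one, not merely a first-order counterpart.
\<close>

class set_universe =
  fixes is_set :: "'a \<Rightarrow> bool"
    and elts :: "'a \<Rightarrow> 'a set"
  assumes elts_urelement: "\<not> is_set x \<Longrightarrow> elts x = {}"
    and set_extensionality: "is_set x \<Longrightarrow> is_set y \<Longrightarrow> elts x = elts y \<Longrightarrow> x = y"
    and set_separation: "is_set x \<Longrightarrow> A \<subseteq> elts x \<Longrightarrow> \<exists>y. is_set y \<and> elts y = A"
    and set_pairing: "\<exists>z. is_set z \<and> elts z = {x, y}"
    and set_union: "is_set x \<Longrightarrow> \<exists>y. is_set y \<and> elts y = (\<Union>z\<in>elts x. elts z)"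
    and set_power: "is_set x \<Longrightarrow> \<exists>y. is_set y \<and> elts y = {z. is_set z \<and> elts z \<subseteq> elts x}"

definition set_of :: "'u set \<Rightarrow> 'u::set_universe" where
  "set_of A = (THE x. is_set x \<and> elts x = A)"

definition kpair :: "'u \<Rightarrow> 'u \<Rightarrow> 'u::set_universe" where
  "kpair x y = set_of {set_of {x}, set_of {x, y}}"

definition triple :: "'u \<Rightarrow> 'u \<Rightarrow> 'u \<Rightarrow> 'u::set_universe" where
  "triple x y z = kpair (kpair x y) z"

text \<open>Function application is total, with the empty set as value where \<open>f\<close> is not single-valued
  or not defined; this makes it a term-forming operation of the formal language below.\<close>

definition app :: "'u \<Rightarrow> 'u \<Rightarrow> 'u::set_universe" where
  "app f x = (if \<exists>!y. kpair x y \<in> elts f then THE y. kpair x y \<in> elts f else set_of {})"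

definition is_map :: "'u::set_universe \<Rightarrow> 'u set \<Rightarrow> 'u set \<Rightarrow> bool" where
  "is_map f A B \<longleftrightarrow> is_set f \<and> (\<forall>p\<in>elts f. \<exists>x\<in>A. \<exists>y\<in>B. p = kpair x y)
     \<and> (\<forall>x\<in>A. \<exists>!y. kpair x y \<in> elts f)"


section \<open>Superstructures, formulas and enlargements\<close>

definition base_set :: "'u::set_universe \<Rightarrow> bool" where
  "base_set S \<longleftrightarrow> is_set S \<and> infinite (elts S) \<and> (\<forall>s\<in>elts S. \<not> is_set s)"

primrec level :: "'u::set_universe \<Rightarrow> nat \<Rightarrow> 'u set" where
  "level S 0 = elts S"
| "level S (Suc n) = level S n \<union> {x. is_set x \<and> elts x \<subseteq> level S n}"

definition hat :: "'u::set_universe \<Rightarrow> 'u set" where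
  "hat S = (\<Union>n. level S n)"

datatype 'c trm = Const 'c | Var nat | PairT "'c trm" "'c trm" | AppT "'c trm" "'c trm"

datatype 'c fm =
    Eq "'c trm" "'c trm"
  | Mem "'c trm" "'c trm"
  | Neg "'c fm"
  | Conj "'c fm" "'c fm"
  | BAll nat "'c trm" "'c fm"

primrec fv_trm :: "'c trm \<Rightarrow> nat set" where
  "fv_trm (Const c) = {}"
| "fv_trm (Var n) = {n}"
| "fv_trm (PairT s t) = fv_trm s \<union> fv_trm t"
| "fv_trm (AppT s t) = fv_trm s \<union> fv_trm t"

text \<open>In \<open>BAll n t \<phi>\<close> the bounding term \<open>t\<close> is outside the scope of the bound variable \<open>n\<close>.\<close>

primrec fv :: "'c fm \<Rightarrow> nat set" where
  "fv (Eq s t) = fv_trm s \<union> fv_trm t"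
| "fv (Mem s t) = fv_trm s \<union> fv_trm t"
| "fv (Neg \<phi>) = fv \<phi>"
| "fv (Conj \<phi> \<psi>) = fv \<phi> \<union> fv \<psi>"
| "fv (BAll n t \<phi>) = fv_trm t \<union> (fv \<phi> - {n})"

primrec val :: "(nat \<Rightarrow> 'u) \<Rightarrow> 'u trm \<Rightarrow> 'u::set_universe" where
  "val e (Const c) = c"
| "val e (Var n) = e n"
| "val e (PairT s t) = kpair (val e s) (val e t)"
| "val e (AppT s t) = app (val e s) (val e t)"

primrec sat :: "(nat \<Rightarrow> 'u) \<Rightarrow> 'u::set_universe fm \<Rightarrow> bool" where
  "sat e (Eq s t) \<longleftrightarrow> val e s = val e t"
| "sat e (Mem s t) \<longleftrightarrow> val e s \<in> elts (val e t)"
| "sat e (Neg \<phi>) \<longleftrightarrow> \<not> sat e \<phi>"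
| "sat e (Conj \<phi> \<psi>) \<longleftrightarrow> sat e \<phi> \<and> sat e \<psi>"
| "sat e (BAll n t \<phi>) \<longleftrightarrow> (\<forall>a\<in>elts (val e t). sat (e(n := a)) \<phi>)"

definition is_true :: "'u::set_universe fm \<Rightarrow> bool" where
  "is_true \<phi> \<longleftrightarrow> (\<forall>e. sat e \<phi>)"

text \<open>\<open>set_fm \<phi>\<close> is the set of constants of \<open>\<phi>\<close>.\<close>

definition statement_in :: "'u::set_universe \<Rightarrow> 'u fm \<Rightarrow> bool" where
  "statement_in S \<phi> \<longleftrightarrow> set_fm \<phi> \<subseteq> hat S \<and> fv \<phi> = {}"

definition internal :: "'u::set_universe \<Rightarrow> ('u \<Rightarrow> 'u) \<Rightarrow> 'u set" where
  "internal S star = (\<Union>A\<in>hat S - elts S. elts (star A))"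

text \<open>Only the values of \<open>star\<close> on \<open>hat S\<close> matter. Index sets of cardinality at most that of
  \<open>hat S\<close> may be taken to be sets of elements of the ambient universe.\<close>

definition saturated :: "'u::set_universe \<Rightarrow> ('u \<Rightarrow> 'u) \<Rightarrow> bool" where
  "saturated S star \<longleftrightarrow>
     (\<forall>(I :: 'u set) U. I \<noteq> {} \<and> I \<lesssim> hat S
        \<and> (\<forall>i\<in>I. U i \<in> internal S star \<and> elts (U i) \<noteq> {})
        \<and> (\<forall>J. J \<subseteq> I \<and> finite J \<and> J \<noteq> {} \<longrightarrow> (\<Inter>j\<in>J. elts (U j)) \<noteq> {})
        \<longrightarrow> (\<Inter>i\<in>I. elts (U i)) \<noteq> {})"

definition enlargement :: "'u::set_universe \<Rightarrow> 'u \<Rightarrow> ('u \<Rightarrow> 'u) \<Rightarrow> bool" where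
  "enlargement S W star \<longleftrightarrow>
     base_set S \<and> base_set W \<and> star ` hat S \<subseteq> hat W
     \<and> star S = W
     \<and> (\<forall>s\<in>elts S. star s = s)
     \<and> (\<forall>\<phi>. statement_in S \<phi> \<longrightarrow> (is_true \<phi> \<longleftrightarrow> is_true (map_fm star \<phi>)))
     \<and> saturated S star"


section \<open>Categories given by their morphisms\<close>

text \<open>The composition relation consists of the triples \<open>triple g f h\<close> with \<open>h = g \<circ> f\<close>.
  As \<open>triple g f h = kpair (kpair g f) h\<close>, it is the graph of composition on composable pairs.\<close>

record 'u cat =
  Mor :: 'u
  Src :: 'u
  Tgt :: 'u
  Comp :: 'u

abbreviation src :: "('u::set_universe, 'm) cat_scheme \<Rightarrow> 'u \<Rightarrow> 'u" where
  "src T f \<equiv> app (Src T) f"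

abbreviation tgt :: "('u::set_universe, 'm) cat_scheme \<Rightarrow> 'u \<Rightarrow> 'u" where
  "tgt T f \<equiv> app (Tgt T) f"

abbreviation cmp :: "('u::set_universe, 'm) cat_scheme \<Rightarrow> 'u \<Rightarrow> 'u \<Rightarrow> 'u" where
  "cmp T g f \<equiv> app (Comp T) (kpair g f)"

definition category :: "('u::set_universe, 'm) cat_scheme \<Rightarrow> bool" where
  "category T \<longleftrightarrow> is_set (Mor T)
     \<and> is_map (Src T) (elts (Mor T)) (elts (Mor T))
     \<and> is_map (Tgt T) (elts (Mor T)) (elts (Mor T))
     \<and> is_map (Comp T)
         {kpair g f |g f. g \<in> elts (Mor T) \<and> f \<in> elts (Mor T) \<and> src T g = tgt T f} (elts (Mor T))
     \<and> (\<forall>f\<in>elts (Mor T). src T (src T f) = src T f \<and> tgt T (src T f) = src T f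
          \<and> src T (tgt T f) = tgt T f \<and> tgt T (tgt T f) = tgt T f)
     \<and> (\<forall>g\<in>elts (Mor T). \<forall>f\<in>elts (Mor T). src T g = tgt T f \<longrightarrow>
          src T (cmp T g f) = src T f \<and> tgt T (cmp T g f) = tgt T g)
     \<and> (\<forall>f\<in>elts (Mor T). cmp T f (src T f) = f \<and> cmp T (tgt T f) f = f)
     \<and> (\<forall>h\<in>elts (Mor T). \<forall>g\<in>elts (Mor T). \<forall>f\<in>elts (Mor T).
          src T h = tgt T g \<and> src T g = tgt T f \<longrightarrow>
          cmp T (cmp T h g) f = cmp T h (cmp T g f))"

definition Obj :: "('u::set_universe, 'm) cat_scheme \<Rightarrow> 'u set" where
  "Obj T = {x \<in> elts (Mor T). src T x = x}"

definition Hom :: "('u::set_universe, 'm) cat_scheme \<Rightarrow> 'u \<Rightarrow> 'u \<Rightarrow> 'u set" where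
  "Hom T x y = {f \<in> elts (Mor T). src T f = x \<and> tgt T f = y}"

definition is_iso :: "('u::set_universe, 'm) cat_scheme \<Rightarrow> 'u \<Rightarrow> bool" where
  "is_iso T f \<longleftrightarrow> f \<in> elts (Mor T)
     \<and> (\<exists>g\<in>Hom T (tgt T f) (src T f). cmp T g f = src T f \<and> cmp T f g = tgt T f)"

definition is_functor ::
  "('u::set_universe, 'm) cat_scheme \<Rightarrow> ('u, 'n) cat_scheme \<Rightarrow> 'u \<Rightarrow> bool" where
  "is_functor T T' F \<longleftrightarrow> category T \<and> category T'
     \<and> is_map F (elts (Mor T)) (elts (Mor T'))
     \<and> (\<forall>f\<in>elts (Mor T). app F (src T f) = src T' (app F f) \<and> app F (tgt T f) = tgt T' (app F f))
     \<and> (\<forall>g\<in>elts (Mor T). \<forall>f\<in>elts (Mor T). src T g = tgt T f \<longrightarrow>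
          app F (cmp T g f) = cmp T' (app F g) (app F f))"

text \<open>Natural isomorphisms between functors with actions \<open>G\<close> and \<open>H\<close> on morphisms.\<close>

definition natural_iso :: "('u::set_universe, 'm) cat_scheme \<Rightarrow> ('u, 'n) cat_scheme
    \<Rightarrow> ('u \<Rightarrow> 'u) \<Rightarrow> ('u \<Rightarrow> 'u) \<Rightarrow> 'u \<Rightarrow> bool" where
  "natural_iso T T' G H \<theta> \<longleftrightarrow> is_map \<theta> (Obj T) (elts (Mor T'))
     \<and> (\<forall>x\<in>Obj T. app \<theta> x \<in> Hom T' (G x) (H x) \<and> is_iso T' (app \<theta> x))
     \<and> (\<forall>f\<in>elts (Mor T). cmp T' (app \<theta> (tgt T f)) (G f) = cmp T' (H f) (app \<theta> (src T f)))"

definition zero_object :: "('u::set_universe, 'm) cat_scheme \<Rightarrow> 'u \<Rightarrow> bool" where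
  "zero_object T z \<longleftrightarrow> z \<in> Obj T
     \<and> (\<forall>x\<in>Obj T. (\<exists>!f. f \<in> Hom T z x) \<and> (\<exists>!f. f \<in> Hom T x z))"


section \<open>Additive categories\<close>

text \<open>\<open>Add\<close> consists of the triples \<open>triple f g h\<close> with \<open>f\<close>, \<open>g\<close> parallel and \<open>h = f + g\<close>.\<close>

record 'u add_cat = "'u cat" +
  Add :: 'u

abbreviation add :: "('u::set_universe, 'm) add_cat_scheme \<Rightarrow> 'u \<Rightarrow> 'u \<Rightarrow> 'u" where
  "add T f g \<equiv> app (Add T) (kpair f g)"

definition Hom_group :: "('u::set_universe, 'm) add_cat_scheme \<Rightarrow> 'u \<Rightarrow> 'u \<Rightarrow> 'u monoid" where
  "Hom_group T x y = \<lparr>carrier = Hom T x y, monoid.mult = add T,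
     one = (THE z. z \<in> Hom T x y \<and> (\<forall>f\<in>Hom T x y. add T z f = f \<and> add T f z = f))\<rparr>"

definition neg :: "('u::set_universe, 'm) add_cat_scheme \<Rightarrow> 'u \<Rightarrow> 'u" where
  "neg T f = m_inv (Hom_group T (src T f) (tgt T f)) f"

definition additive_category :: "('u::set_universe, 'm) add_cat_scheme \<Rightarrow> bool" where
  "additive_category T \<longleftrightarrow> category T
     \<and> is_map (Add T)
         {kpair f g |f g. f \<in> elts (Mor T) \<and> g \<in> elts (Mor T) \<and> src T f = src T g \<and> tgt T f = tgt T g}
         (elts (Mor T))
     \<and> (\<forall>x\<in>Obj T. \<forall>y\<in>Obj T. comm_group (Hom_group T x y))
     \<and> (\<forall>x\<in>Obj T. \<forall>y\<in>Obj T. \<forall>z\<in>Obj T.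
          \<forall>f\<in>Hom T x y. \<forall>f'\<in>Hom T x y. \<forall>g\<in>Hom T y z. \<forall>g'\<in>Hom T y z.
            cmp T g (add T f f') = add T (cmp T g f) (cmp T g f')
            \<and> cmp T (add T g g') f = add T (cmp T g f) (cmp T g' f))
     \<and> (\<exists>z. zero_object T z)
     \<and> (\<forall>x\<in>Obj T. \<forall>y\<in>Obj T. \<exists>b\<in>Obj T.
          \<exists>i\<in>Hom T x b. \<exists>j\<in>Hom T y b. \<exists>p\<in>Hom T b x. \<exists>q\<in>Hom T b y.
            cmp T p i = x \<and> cmp T q j = y \<and> add T (cmp T i p) (cmp T j q) = b)"

definition additive_functor ::
  "('u::set_universe, 'm) add_cat_scheme \<Rightarrow> ('u, 'n) add_cat_scheme \<Rightarrow> 'u \<Rightarrow> bool" where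
  "additive_functor T T' F \<longleftrightarrow> additive_category T \<and> additive_category T' \<and> is_functor T T' F
     \<and> (\<forall>x\<in>Obj T. \<forall>y\<in>Obj T. \<forall>f\<in>Hom T x y. \<forall>g\<in>Hom T x y.
          app F (add T f g) = add T' (app F f) (app F g))"


section \<open>Triangulated categories\<close>

text \<open>A triangle \<open>X \<rightarrow> Y \<rightarrow> Z \<rightarrow> \<Sigma>X\<close> is determined by its three morphisms, since objects are identity
  morphisms; \<open>Tri\<close> consists of the corresponding triples \<open>triple u v w\<close>.\<close>

record 'u tri_cat = "'u add_cat" +
  Shift :: 'u
  Tri :: 'u

abbreviation shift :: "('u::set_universe, 'm) tri_cat_scheme \<Rightarrow> 'u \<Rightarrow> 'u" where
  "shift T f \<equiv> app (Shift T) f"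

definition automorphism :: "('u::set_universe, 'm) add_cat_scheme \<Rightarrow> 'u \<Rightarrow> bool" where
  "automorphism T F \<longleftrightarrow> additive_functor T T F \<and> bij_betw (app F) (elts (Mor T)) (elts (Mor T))"

definition triangle :: "('u::set_universe, 'm) tri_cat_scheme \<Rightarrow> 'u \<Rightarrow> 'u \<Rightarrow> 'u \<Rightarrow> bool" where
  "triangle T u v w \<longleftrightarrow> u \<in> elts (Mor T) \<and> v \<in> elts (Mor T) \<and> w \<in> elts (Mor T)
     \<and> src T v = tgt T u \<and> src T w = tgt T v \<and> tgt T w = shift T (src T u)"

definition distinguished :: "('u::set_universe, 'm) tri_cat_scheme \<Rightarrow> 'u \<Rightarrow> 'u \<Rightarrow> 'u \<Rightarrow> bool" where
  "distinguished T u v w \<longleftrightarrow> triple u v w \<in> elts (Tri T)"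

definition triangle_morphism :: "('u::set_universe, 'm) tri_cat_scheme
    \<Rightarrow> 'u \<Rightarrow> 'u \<Rightarrow> 'u \<Rightarrow> 'u \<Rightarrow> 'u \<Rightarrow> 'u \<Rightarrow> 'u \<Rightarrow> 'u \<Rightarrow> 'u \<Rightarrow> bool" where
  "triangle_morphism T u v w u' v' w' f g h \<longleftrightarrow>
     f \<in> Hom T (src T u) (src T u') \<and> g \<in> Hom T (tgt T u) (tgt T u') \<and> h \<in> Hom T (tgt T v) (tgt T v')
     \<and> cmp T g u = cmp T u' f \<and> cmp T h v = cmp T v' g \<and> cmp T (shift T f) w = cmp T w' h"

definition TR1 :: "('u::set_universe, 'm) tri_cat_scheme \<Rightarrow> bool" where
  "TR1 T \<longleftrightarrow>
     (\<forall>u v w u' v' w' f g h. distinguished T u v w \<and> triangle T u' v' w'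
        \<and> triangle_morphism T u v w u' v' w' f g h \<and> is_iso T f \<and> is_iso T g \<and> is_iso T h
        \<longrightarrow> distinguished T u' v' w')
     \<and> (\<forall>x z. x \<in> Obj T \<and> zero_object T z
          \<longrightarrow> (\<forall>v\<in>Hom T x z. \<forall>w\<in>Hom T z (shift T x). distinguished T x v w))
     \<and> (\<forall>u\<in>elts (Mor T). \<exists>v w. distinguished T u v w)"

definition TR2 :: "('u::set_universe, 'm) tri_cat_scheme \<Rightarrow> bool" where
  "TR2 T \<longleftrightarrow>
     (\<forall>u v w. triangle T u v w \<longrightarrow>
        (distinguished T u v w \<longleftrightarrow> distinguished T v w (neg T (shift T u))))"

definition TR3 :: "('u::set_universe, 'm) tri_cat_scheme \<Rightarrow> bool" where
  "TR3 T \<longleftrightarrow>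
     (\<forall>u v w u' v' w' f g. distinguished T u v w \<and> distinguished T u' v' w'
        \<and> f \<in> Hom T (src T u) (src T u') \<and> g \<in> Hom T (tgt T u) (tgt T u')
        \<and> cmp T g u = cmp T u' f
        \<longrightarrow> (\<exists>h. triangle_morphism T u v w u' v' w' f g h))"

text \<open>Octahedral axiom. The given distinguished triangles are
  \<open>X \<rightarrow>u Y \<rightarrow>j Z' \<rightarrow>k \<Sigma>X\<close>, \<open>Y \<rightarrow>v Z \<rightarrow>l X' \<rightarrow>i \<Sigma>Y\<close> and \<open>X \<rightarrow>vu Z \<rightarrow>m Y' \<rightarrow>n \<Sigma>X\<close>;
  the one to be found is \<open>Z' \<rightarrow>f Y' \<rightarrow>g X' \<rightarrow> \<Sigma>Z'\<close> with third morphism \<open>\<Sigma>j \<circ> i\<close>.\<close>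

definition TR4 :: "('u::set_universe, 'm) tri_cat_scheme \<Rightarrow> bool" where
  "TR4 T \<longleftrightarrow>
     (\<forall>u v j k l i m n. src T v = tgt T u
        \<and> distinguished T u j k \<and> distinguished T v l i \<and> distinguished T (cmp T v u) m n
        \<longrightarrow> (\<exists>f\<in>Hom T (tgt T j) (tgt T m). \<exists>g\<in>Hom T (tgt T m) (tgt T l).
              distinguished T f g (cmp T (shift T j) i)
              \<and> cmp T f j = cmp T m v \<and> cmp T n f = k
              \<and> cmp T g m = l \<and> cmp T i g = cmp T (shift T u) n))"

definition triangulated_category :: "('u::set_universe, 'm) tri_cat_scheme \<Rightarrow> bool" where
  "triangulated_category T \<longleftrightarrow> additive_category T \<and> automorphism T (Shift T)
     \<and> is_set (Tri T) \<and> (\<forall>p\<in>elts (Tri T). \<exists>u v w. p = triple u v w \<and> triangle T u v w)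
     \<and> TR1 T \<and> TR2 T \<and> TR3 T \<and> TR4 T"

text \<open>All other components are maps or relations on \<open>Mor T\<close> and so lie in \<open>hat S\<close> as well.\<close>

definition small_triangulated_category ::
  "'u::set_universe \<Rightarrow> ('u, 'm) tri_cat_scheme \<Rightarrow> bool" where
  "small_triangulated_category S T \<longleftrightarrow> triangulated_category T \<and> Mor T \<in> hat S - elts S"

text \<open>Compatibility with the automorphisms means a natural isomorphism \<open>\<theta> : F\<Sigma> \<cong> \<Sigma>'F\<close>; the image of
  a triangle \<open>(u, v, w)\<close> starting at \<open>X\<close> is \<open>(Fu, Fv, \<theta>\<^sub>X \<circ> Fw)\<close>.\<close>

definition triangulated_functor ::
  "('u::set_universe, 'm) tri_cat_scheme \<Rightarrow> ('u, 'n) tri_cat_scheme \<Rightarrow> 'u \<Rightarrow> bool" where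
  "triangulated_functor T T' F \<longleftrightarrow> triangulated_category T \<and> triangulated_category T'
     \<and> additive_functor T T' F
     \<and> (\<exists>\<theta>. natural_iso T T' (\<lambda>f. app F (shift T f)) (\<lambda>f. shift T' (app F f)) \<theta>
          \<and> (\<forall>u v w. distinguished T u v w \<longrightarrow>
               distinguished T' (app F u) (app F v) (cmp T' (app \<theta> (src T u)) (app F w))))"

definition enlarge :: "('u \<Rightarrow> 'u) \<Rightarrow> 'u tri_cat \<Rightarrow> 'u tri_cat" where
  "enlarge star T = \<lparr>Mor = star (Mor T), Src = star (Src T), Tgt = star (Tgt T),
     Comp = star (Comp T), Add = star (Add T), Shift = star (Shift T), Tri = star (Tri T)\<rparr>"

end

theory Submission
  imports Defs
begin

text \<open>
  The theorem is an instance of transfer: being a functor of triangulated categories is expressible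
  by formulas with bounded quantifiers whose constants are the components of \<open>T\<close> and \<open>T'\<close>, the
  functor \<open>F\<close> and a natural isomorphism \<open>\<theta> : F\<Sigma> \<cong> \<Sigma>'F\<close>. The choice of \<open>\<theta>\<close> precedes transfer, so that its
  enlargement is the natural isomorphism required for the enlargement of \<open>F\<close>.

  Each notion is written as a formula that is a function of the category record, such as
  \<open>triangulated_fm T\<close>, and its satisfaction is shown to be equivalent to the notion for an arbitrary
  record, not only for one inside a superstructure (\<open>sat_triangulated_fm\<close>, \<open>sat_functor_fm\<close>,
  \<open>sat_compatible_fm\<close>). Since replacing constants by their images turns \<open>triangulated_fm T\<close> into
  \<open>triangulated_fm (enlarge star T)\<close>, the same equivalence is used once before and once after transfer.

  Four points need an argument. Quantifiers over the whole universe are bounded by the set of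
  morphisms, because distinguished triangles consist of morphisms and Kuratowski pairs are
  injective. The negative of a morphism, defined by a description in the group of morphisms, is
  replaced by the characterization \<open>neg_eq_iff\<close>. All constants lie in the superstructure, because
  maps and relations between subsets of one level lie a few levels higher (\<open>map_in_hat\<close>). Finally,
  being a set rather than an urelement is not a formula of the language; it is preserved because an
  element of a superstructure is a set iff it is not an element of the base set (\<open>is_set_star\<close>).
\<close>

section \<open>Pairs and maps in the ambient universe\<close>

lemma set_of_eqI:
  assumes "is_set (x::'u::set_universe)" "elts x = A"
  shows "set_of A = x"
  unfolding set_of_def using assms by (intro the_equality) (auto intro: set_extensionality)

lemma set_of_pair:
  shows is_set_set_of_pair: "is_set (set_of {x, y::'u::set_universe})"
    and elts_set_of_pair: "elts (set_of {x, y}) = {x, y}"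
proof -
  obtain z where "is_set z" "elts z = {x, y}"
    using set_pairing by blast
  then show "is_set (set_of {x, y})" "elts (set_of {x, y}) = {x, y}"
    using set_of_eqI by blast+
qed

lemma set_of_pair_inject: "set_of {x, y} = set_of {x', y'} \<longleftrightarrow> {x, y} = {x', y'}"
  for x y x' y' :: "'u::set_universe"
  by (metis elts_set_of_pair)

lemma kpair_inject [simp]: "kpair x y = kpair x' y' \<longleftrightarrow> x = x' \<and> y = y'"
  for x y x' y' :: "'u::set_universe"
proof -
  have "set_of {a} = set_of {b, c} \<longleftrightarrow> a = b \<and> a = c" for a b c :: 'u
    using set_of_pair_inject[of a a b c] by auto
  moreover have "set_of {b, c} = set_of {a} \<longleftrightarrow> a = b \<and> a = c" for a b c :: 'u
    using set_of_pair_inject[of b c a a] by auto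
  moreover have "set_of {a} = set_of {b} \<longleftrightarrow> a = b" for a b :: 'u
    using set_of_pair_inject[of a a b b] by auto
  ultimately show ?thesis
    unfolding kpair_def set_of_pair_inject by (auto simp: doubleton_eq_iff set_of_pair_inject)
qed

lemma triple_inject [simp]: "triple x y z = triple x' y' z' \<longleftrightarrow> x = x' \<and> y = y' \<and> z = z'"
  for x y z x' y' z' :: "'u::set_universe"
  by (simp add: triple_def)

text \<open>The uniqueness clause in the definition of maps ranges over the whole universe; here it is
  bounded by the codomain.\<close>

lemma is_map_iff_bounded:
  "is_map f A B \<longleftrightarrow> is_set f \<and> (\<forall>p\<in>elts f. \<exists>x\<in>A. \<exists>y\<in>B. p = kpair x y)
     \<and> (\<forall>x\<in>A. \<exists>y\<in>B. kpair x y \<in> elts f \<and> (\<forall>y'\<in>B. kpair x y' \<in> elts f \<longrightarrow> y' = y))"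
proof -
  have "(\<exists>!y. kpair x y \<in> elts f)
      \<longleftrightarrow> (\<exists>y\<in>B. kpair x y \<in> elts f \<and> (\<forall>y'\<in>B. kpair x y' \<in> elts f \<longrightarrow> y' = y))"
    if "\<forall>p\<in>elts f. \<exists>x\<in>A. \<exists>y\<in>B. p = kpair x y" for x
  proof -
    have "y \<in> B" if "kpair x y \<in> elts f" for y
      using that \<open>\<forall>p\<in>elts f. _ p\<close> by fastforce
    then show ?thesis by blast
  qed
  then show ?thesis unfolding is_map_def by blast
qed

section \<open>Superstructures\<close>

lemma level_mono: "m \<le> n \<Longrightarrow> level S m \<subseteq> level S n"
  by (induction n) (auto simp: le_Suc_eq)

text \<open>Levels are transitive: the elements of the base set are urelements.\<close>

lemma elts_level:
  assumes "base_set S" "x \<in> level S n"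
  shows "elts x \<subseteq> level S n"
  using assms(2)
proof (induction n)
  case 0
  then show ?case using assms(1) elts_urelement by (fastforce simp: base_set_def)
qed auto

lemma is_set_level:
  assumes "is_set x" "elts x \<subseteq> level S n"
  shows "x \<in> hat S"
  using assms unfolding hat_def by (intro UN_I[of "Suc n"]) auto

lemma is_set_hat: "x \<in> hat S \<Longrightarrow> x \<notin> elts S \<Longrightarrow> is_set x"
proof -
  have "x \<in> level S n \<Longrightarrow> x \<notin> elts S \<Longrightarrow> is_set x" for n
    by (induction n) auto
  then show "x \<in> hat S \<Longrightarrow> x \<notin> elts S \<Longrightarrow> is_set x"
    by (auto simp: hat_def)
qed

lemma kpair_level:
  assumes "x \<in> level S n" "y \<in> level S n"
  shows "kpair x y \<in> level S (Suc (Suc n))"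
proof -
  have "set_of {x, x} \<in> level S (Suc n)" "set_of {x, y} \<in> level S (Suc n)"
    using assms by (simp_all add: elts_set_of_pair is_set_set_of_pair del: insert_absorb2)
  then show ?thesis
    by (simp add: kpair_def elts_set_of_pair is_set_set_of_pair)
qed

lemma map_in_hat:
  assumes "is_map f A B" "A \<subseteq> level S n" "B \<subseteq> level S n"
  shows "f \<in> hat S"
proof (rule is_set_level)
  show "is_set f" using assms(1) by (simp add: is_map_def)
  show "elts f \<subseteq> level S (Suc (Suc n))"
  proof
    fix p assume "p \<in> elts f"
    then obtain x y where "x \<in> A" "y \<in> B" "p = kpair x y"
      using assms(1) unfolding is_map_def by blast
    then show "p \<in> level S (Suc (Suc n))"
      using assms(2,3) kpair_level by blast
  qed
qed

section \<open>Formulas and transfer\<close>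

lemma val_upd [simp]: "n \<notin> fv_trm t \<Longrightarrow> val (e(n := a)) t = val e t"
  by (induction t) auto

text \<open>Atomic formulas and connectives of the formal language are written in bold.\<close>

notation Eq (infix "\<^bold>=" 50)
notation Mem (infix "\<^bold>\<in>" 50)
notation Conj (infixr "\<^bold>\<and>" 35)

definition Imp :: "'c fm \<Rightarrow> 'c fm \<Rightarrow> 'c fm" (infixr "\<^bold>\<longrightarrow>" 25) where
  "Imp \<phi> \<psi> = Neg (Conj \<phi> (Neg \<psi>))"

definition Iff :: "'c fm \<Rightarrow> 'c fm \<Rightarrow> 'c fm" (infix "\<^bold>\<longleftrightarrow>" 25) where
  "Iff \<phi> \<psi> = Conj (Imp \<phi> \<psi>) (Imp \<psi> \<phi>)"

definition BEx :: "nat \<Rightarrow> 'c trm \<Rightarrow> 'c fm \<Rightarrow> 'c fm" where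
  "BEx n t \<phi> = Neg (BAll n t (Neg \<phi>))"

primrec BAlls :: "nat list \<Rightarrow> 'c trm \<Rightarrow> 'c fm \<Rightarrow> 'c fm" where
  "BAlls [] t \<phi> = \<phi>"
| "BAlls (n # ns) t \<phi> = BAll n t (BAlls ns t \<phi>)"

lemma sat_connectives [simp]:
  "sat e (\<phi> \<^bold>\<longrightarrow> \<psi>) \<longleftrightarrow> (sat e \<phi> \<longrightarrow> sat e \<psi>)"
  "sat e (\<phi> \<^bold>\<longleftrightarrow> \<psi>) \<longleftrightarrow> (sat e \<phi> \<longleftrightarrow> sat e \<psi>)"
  "sat e (BEx n t \<phi>) \<longleftrightarrow> (\<exists>a\<in>elts (val e t). sat (e(n := a)) \<phi>)"
  by (auto simp: Imp_def Iff_def BEx_def)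

text \<open>Terms of the language for triples, for the operations of a category and for its set of morphisms.\<close>

abbreviation tripT :: "'c trm \<Rightarrow> 'c trm \<Rightarrow> 'c trm \<Rightarrow> 'c trm" where
  "tripT a b c \<equiv> PairT (PairT a b) c"

abbreviation "srcT T a \<equiv> AppT (Const (Src T)) a"
abbreviation "tgtT T a \<equiv> AppT (Const (Tgt T)) a"
abbreviation "cmpT T a b \<equiv> AppT (Const (Comp T)) (PairT a b)"
abbreviation "addT T a b \<equiv> AppT (Const (Add T)) (PairT a b)"
abbreviation "shiftT T a \<equiv> AppT (Const (Shift T)) a"

abbreviation "MorT T \<equiv> Const (Mor T)"

text \<open>Formulas for membership in the objects and in the morphisms from \<open>x\<close> to \<open>y\<close>, and quantifiers
  bounded by these subsets of the set of morphisms.\<close>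

definition Obj_fm :: "('c, 'm) cat_scheme \<Rightarrow> 'c trm \<Rightarrow> 'c fm" where
  "Obj_fm T x = (x \<^bold>\<in> MorT T \<^bold>\<and> srcT T x \<^bold>= x)"

definition Hom_fm :: "('c, 'm) cat_scheme \<Rightarrow> 'c trm \<Rightarrow> 'c trm \<Rightarrow> 'c trm \<Rightarrow> 'c fm" where
  "Hom_fm T f x y = (f \<^bold>\<in> MorT T \<^bold>\<and> srcT T f \<^bold>= x \<^bold>\<and> tgtT T f \<^bold>= y)"

definition AllObj :: "('c, 'm) cat_scheme \<Rightarrow> nat \<Rightarrow> 'c fm \<Rightarrow> 'c fm" where
  "AllObj T n \<phi> = BAll n (MorT T) (Obj_fm T (Var n) \<^bold>\<longrightarrow> \<phi>)"

definition ExObj :: "('c, 'm) cat_scheme \<Rightarrow> nat \<Rightarrow> 'c fm \<Rightarrow> 'c fm" where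
  "ExObj T n \<phi> = BEx n (MorT T) (Obj_fm T (Var n) \<^bold>\<and> \<phi>)"

definition AllHom :: "('c, 'm) cat_scheme \<Rightarrow> nat \<Rightarrow> 'c trm \<Rightarrow> 'c trm \<Rightarrow> 'c fm \<Rightarrow> 'c fm" where
  "AllHom T n x y \<phi> = BAll n (MorT T) (Hom_fm T (Var n) x y \<^bold>\<longrightarrow> \<phi>)"

definition ExHom :: "('c, 'm) cat_scheme \<Rightarrow> nat \<Rightarrow> 'c trm \<Rightarrow> 'c trm \<Rightarrow> 'c fm \<Rightarrow> 'c fm" where
  "ExHom T n x y \<phi> = BEx n (MorT T) (Hom_fm T (Var n) x y \<^bold>\<and> \<phi>)"

lemma sat_Obj_Hom [simp]:
  "sat e (Obj_fm T x) \<longleftrightarrow> val e x \<in> Obj T"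
  "sat e (Hom_fm T f x y) \<longleftrightarrow> val e f \<in> Hom T (val e x) (val e y)"
  "sat e (AllObj T n \<phi>) \<longleftrightarrow> (\<forall>a\<in>Obj T. sat (e(n := a)) \<phi>)"
  "sat e (ExObj T n \<phi>) \<longleftrightarrow> (\<exists>a\<in>Obj T. sat (e(n := a)) \<phi>)"
  by (auto simp: Obj_fm_def Hom_fm_def Obj_def Hom_def AllObj_def ExObj_def)

lemma sat_AllHom [simp]:
  assumes "n \<notin> fv_trm x" "n \<notin> fv_trm y"
  shows "sat e (AllHom T n x y \<phi>) \<longleftrightarrow> (\<forall>a\<in>Hom T (val e x) (val e y). sat (e(n := a)) \<phi>)"
    and "sat e (ExHom T n x y \<phi>) \<longleftrightarrow> (\<exists>a\<in>Hom T (val e x) (val e y). sat (e(n := a)) \<phi>)"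
  using assms by (auto simp: AllHom_def ExHom_def Hom_def)

text \<open>The formula says that \<open>f\<close> is the graph of a map into \<open>B\<close> defined on those \<open>x \<in> A\<close> that satisfy \<open>D x\<close>,
  except that it cannot say that \<open>f\<close> is a set. The variant for two arguments has as its domain the
  pairs of elements of \<open>A\<close> related by \<open>D\<close>.\<close>

definition unary_map_fm :: "'c \<Rightarrow> 'c \<Rightarrow> 'c \<Rightarrow> ('c trm \<Rightarrow> 'c fm) \<Rightarrow> 'c fm" where
  "unary_map_fm f A B D =
    (BAll 0 (Const f) (BEx 1 (Const A) (D (Var 1) \<^bold>\<and> BEx 2 (Const B) (Var 0 \<^bold>= PairT (Var 1) (Var 2))))
     \<^bold>\<and> BAll 1 (Const A) (D (Var 1) \<^bold>\<longrightarrow> BEx 2 (Const B) (PairT (Var 1) (Var 2) \<^bold>\<in> Const f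
         \<^bold>\<and> BAll 3 (Const B) (PairT (Var 1) (Var 3) \<^bold>\<in> Const f \<^bold>\<longrightarrow> Var 3 \<^bold>= Var 2))))"

definition binary_map_fm :: "'c \<Rightarrow> 'c \<Rightarrow> 'c \<Rightarrow> ('c trm \<Rightarrow> 'c trm \<Rightarrow> 'c fm) \<Rightarrow> 'c fm" where
  "binary_map_fm f A B D =
    (BAll 0 (Const f) (BEx 1 (Const A) (BEx 4 (Const A) (D (Var 1) (Var 4) \<^bold>\<and>
        BEx 2 (Const B) (Var 0 \<^bold>= tripT (Var 1) (Var 4) (Var 2)))))
     \<^bold>\<and> BAll 1 (Const A) (BAll 4 (Const A) (D (Var 1) (Var 4) \<^bold>\<longrightarrow>
         BEx 2 (Const B) (tripT (Var 1) (Var 4) (Var 2) \<^bold>\<in> Const f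
         \<^bold>\<and> BAll 3 (Const B) (tripT (Var 1) (Var 4) (Var 3) \<^bold>\<in> Const f \<^bold>\<longrightarrow> Var 3 \<^bold>= Var 2)))))"

text \<open>The hypothesis says that the truth of \<open>D x\<close> depends on the value of the variable \<open>x\<close> only, so that
  the other bound variables of the formula are not captured.\<close>

lemma sat_unary_map_fm:
  assumes "\<And>e n. sat e (D (Var n)) \<longleftrightarrow> P (e n)"
  shows "is_map f {x \<in> elts A. P x} (elts B) \<longleftrightarrow> is_set f \<and> sat e (unary_map_fm f A B D)"
proof -
  have "(\<forall>x\<in>{x \<in> elts A. P x}. Q x) \<longleftrightarrow> (\<forall>x\<in>elts A. P x \<longrightarrow> Q x)"
    and "(\<exists>x\<in>{x \<in> elts A. P x}. Q x) \<longleftrightarrow> (\<exists>x\<in>elts A. P x \<and> Q x)" for Q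
    by blast+
  then show ?thesis
    unfolding is_map_iff_bounded unary_map_fm_def by (simp add: assms)
qed

lemma sat_binary_map_fm:
  assumes "\<And>e m n. sat e (D (Var m) (Var n)) \<longleftrightarrow> P (e m) (e n)"
  shows "is_map f {kpair x y |x y. x \<in> elts A \<and> y \<in> elts A \<and> P x y} (elts B)
    \<longleftrightarrow> is_set f \<and> sat e (binary_map_fm f A B D)"
proof -
  let ?D = "{kpair x y |x y. x \<in> elts A \<and> y \<in> elts A \<and> P x y}"
  have "(\<forall>p\<in>?D. Q p) \<longleftrightarrow> (\<forall>x\<in>elts A. \<forall>y\<in>elts A. P x y \<longrightarrow> Q (kpair x y))"
    and "(\<exists>p\<in>?D. Q p) \<longleftrightarrow> (\<exists>x\<in>elts A. \<exists>y\<in>elts A. P x y \<and> Q (kpair x y))" for Q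
    by blast+
  then show ?thesis
    unfolding is_map_iff_bounded binary_map_fm_def by (simp add: assms)
qed

lemma transfer:
  assumes "enlargement S W star" "set_fm \<phi> \<subseteq> hat S" "fv \<phi> = {}" "\<And>e. sat e \<phi>"
  shows "sat e (map_fm star \<phi>)"
  using assms unfolding enlargement_def statement_in_def is_true_def by blast

text \<open>The statement transferred is \<open>A \<notin> S\<close>. Its image says that the enlargement of \<open>A\<close>, an element of
  the superstructure over \<open>W\<close>, is not in \<open>W\<close>.\<close>

lemma is_set_star:
  assumes "enlargement S W star" "A \<in> hat S" "is_set A"
  shows "is_set (star A)"
proof -
  have base: "base_set S" and W: "star S = W" "star ` hat S \<subseteq> hat W"
    using assms(1) by (simp_all add: enlargement_def)
  have "S \<in> hat S"
    using base is_set_level[of S S 0] by (simp add: base_set_def)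
  moreover have "A \<notin> elts S"
    using base assms(3) by (auto simp: base_set_def)
  ultimately have "sat (\<lambda>_. A) (map_fm star (Neg (Const A \<^bold>\<in> Const S)))"
    using assms by (intro transfer[OF assms(1)]) auto
  then show ?thesis
    using W assms(2) by (intro is_set_hat[of _ W]) auto
qed

section \<open>Additive categories\<close>

text \<open>Formula for the axioms of a category, up to the requirement that the components be sets.\<close>

definition category_fm :: "('c, 'm) cat_scheme \<Rightarrow> 'c fm" where
  "category_fm T =
    (unary_map_fm (Src T) (Mor T) (Mor T) (\<lambda>x. x \<^bold>= x)
     \<^bold>\<and> unary_map_fm (Tgt T) (Mor T) (Mor T) (\<lambda>x. x \<^bold>= x)
     \<^bold>\<and> binary_map_fm (Comp T) (Mor T) (Mor T) (\<lambda>g f. srcT T g \<^bold>= tgtT T f)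
     \<^bold>\<and> BAll 0 (MorT T) (
          srcT T (srcT T (Var 0)) \<^bold>= srcT T (Var 0) \<^bold>\<and> tgtT T (srcT T (Var 0)) \<^bold>= srcT T (Var 0)
          \<^bold>\<and> srcT T (tgtT T (Var 0)) \<^bold>= tgtT T (Var 0) \<^bold>\<and> tgtT T (tgtT T (Var 0)) \<^bold>= tgtT T (Var 0))
     \<^bold>\<and> BAlls [1, 0] (MorT T) (srcT T (Var 1) \<^bold>= tgtT T (Var 0) \<^bold>\<longrightarrow>
          srcT T (cmpT T (Var 1) (Var 0)) \<^bold>= srcT T (Var 0)
          \<^bold>\<and> tgtT T (cmpT T (Var 1) (Var 0)) \<^bold>= tgtT T (Var 1))
     \<^bold>\<and> BAll 0 (MorT T) (cmpT T (Var 0) (srcT T (Var 0)) \<^bold>= Var 0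
          \<^bold>\<and> cmpT T (tgtT T (Var 0)) (Var 0) \<^bold>= Var 0)
     \<^bold>\<and> BAlls [2, 1, 0] (MorT T) (
          srcT T (Var 2) \<^bold>= tgtT T (Var 1) \<^bold>\<and> srcT T (Var 1) \<^bold>= tgtT T (Var 0) \<^bold>\<longrightarrow>
          cmpT T (cmpT T (Var 2) (Var 1)) (Var 0) \<^bold>= cmpT T (Var 2) (cmpT T (Var 1) (Var 0))))"

lemma sat_category_fm:
  "category T \<longleftrightarrow> is_set (Mor T) \<and> is_set (Src T) \<and> is_set (Tgt T) \<and> is_set (Comp T)
    \<and> sat e (category_fm T)"
proof -
  have 1: "is_map f (elts A) (elts B) \<longleftrightarrow> is_set f \<and> sat e (unary_map_fm f A B (\<lambda>x. x \<^bold>= x))" for f A B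
    using sat_unary_map_fm[of "\<lambda>x. x \<^bold>= x" "\<lambda>x. True"] by simp
  have 2: "is_map f {kpair x y |x y. x \<in> elts A \<and> y \<in> elts A \<and> src T x = tgt T y} (elts B)
     \<longleftrightarrow> is_set f \<and> sat e (binary_map_fm f A B (\<lambda>g f. srcT T g \<^bold>= tgtT T f))" for f A B
    by (rule sat_binary_map_fm) simp
  show ?thesis
    unfolding category_def category_fm_def 1 2
    by (simp, intro impI iffI conjI; (elim conjE)?; assumption)
qed

text \<open>The parameter \<open>z\<close>, at most \<open>19\<close>, is the index of the free variable of the formula. The bound variables start
  at \<open>20\<close> to stay clear of the variables of the formulas in which this one occurs.\<close>

definition zero_object_fm :: "('c, 'm) cat_scheme \<Rightarrow> nat \<Rightarrow> 'c fm" where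
  "zero_object_fm T z = (Obj_fm T (Var z) \<^bold>\<and> AllObj T 20 (
     ExHom T 21 (Var z) (Var 20) (AllHom T 22 (Var z) (Var 20) (Var 22 \<^bold>= Var 21))
     \<^bold>\<and> ExHom T 21 (Var 20) (Var z) (AllHom T 22 (Var 20) (Var z) (Var 22 \<^bold>= Var 21))))"

lemma sat_zero_object_fm [simp]:
  "z < 20 \<Longrightarrow> sat e (zero_object_fm T z) \<longleftrightarrow> zero_object T (e z)"
  unfolding zero_object_fm_def zero_object_def by (simp add: Ex1_def Bex_def Ball_def)

text \<open>The variable \<open>20\<close> must not occur in the term \<open>f\<close>.\<close>

definition is_iso_fm :: "('c, 'm) cat_scheme \<Rightarrow> 'c trm \<Rightarrow> 'c fm" where
  "is_iso_fm T f = (f \<^bold>\<in> MorT T \<^bold>\<and> ExHom T 20 (tgtT T f) (srcT T f)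
     (cmpT T (Var 20) f \<^bold>= srcT T f \<^bold>\<and> cmpT T f (Var 20) \<^bold>= tgtT T f))"

lemma sat_is_iso_fm [simp]: "20 \<notin> fv_trm f \<Longrightarrow> sat e (is_iso_fm T f) \<longleftrightarrow> is_iso T (val e f)"
  unfolding is_iso_fm_def is_iso_def by simp

text \<open>The unit of the group of morphisms is a description; here it is replaced by an existential
  quantifier.\<close>

lemma comm_group_Hom_group_iff:
  "comm_group (Hom_group T x y) \<longleftrightarrow>
     (\<forall>f\<in>Hom T x y. \<forall>g\<in>Hom T x y. add T f g \<in> Hom T x y \<and> add T f g = add T g f
        \<and> (\<forall>h\<in>Hom T x y. add T (add T f g) h = add T f (add T g h)))
     \<and> (\<exists>z\<in>Hom T x y. \<forall>f\<in>Hom T x y. add T z f = f \<and> (\<exists>g\<in>Hom T x y. add T f g = z))"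
    (is "?L \<longleftrightarrow> ?R")
proof
  assume ?L
  then interpret comm_group "Hom_group T x y" .
  let ?one = "\<one>\<^bsub>Hom_group T x y\<^esub>"
  have "?one \<in> Hom T x y"
    using one_closed by (simp add: Hom_group_def)
  moreover have "add T ?one f = f \<and> (\<exists>g\<in>Hom T x y. add T f g = ?one)" if "f \<in> Hom T x y" for f
    using that l_one[of f] r_inv_ex[of f] by (simp add: Hom_group_def)
  moreover have "add T f g \<in> Hom T x y \<and> add T f g = add T g f
      \<and> (\<forall>h\<in>Hom T x y. add T (add T f g) h = add T f (add T g h))"
    if "f \<in> Hom T x y" "g \<in> Hom T x y" for f g
    using that m_closed[of f g] m_comm[of f g] m_assoc[of f g] by (simp add: Hom_group_def)
  ultimately show ?R by blast
next
  assume R: ?R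
  then obtain z where z: "z \<in> Hom T x y" "\<And>f. f \<in> Hom T x y \<Longrightarrow> add T z f = f"
      "\<And>f. f \<in> Hom T x y \<Longrightarrow> \<exists>g\<in>Hom T x y. add T f g = z"
    by blast
  have closed: "add T f g \<in> Hom T x y" and comm: "add T f g = add T g f"
    if "f \<in> Hom T x y" "g \<in> Hom T x y" for f g
    using R that by blast+
  have "(THE z. z \<in> Hom T x y \<and> (\<forall>f\<in>Hom T x y. add T z f = f \<and> add T f z = f)) = z"
    using z comm by (intro the_equality) metis+
  then have Hom_group: "Hom_group T x y = \<lparr>carrier = Hom T x y, monoid.mult = add T, one = z\<rparr>"
    by (simp add: Hom_group_def)
  show ?L
    unfolding Hom_group
  proof (rule comm_groupI, simp_all add: z closed)
    show "add T (add T f g) h = add T f (add T g h)"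
      if "f \<in> Hom T x y" "g \<in> Hom T x y" "h \<in> Hom T x y" for f g h
      using R that by blast
    show "add T f g = add T g f" if "f \<in> Hom T x y" "g \<in> Hom T x y" for f g
      using comm that .
    show "\<exists>g\<in>Hom T x y. add T g f = z" if "f \<in> Hom T x y" for f
      using z(3) comm that by metis
  qed
qed

lemma additive_category_imp_category: "additive_category T \<Longrightarrow> category T"
  by (simp add: additive_category_def)

lemma is_map_app: "is_map f A B \<Longrightarrow> x \<in> A \<Longrightarrow> app f x \<in> B"
proof -
  assume f: "is_map f A B" and "x \<in> A"
  then have "\<exists>!y. kpair x y \<in> elts f" by (simp add: is_map_def)
  then have "kpair x (app f x) \<in> elts f" using theI'[of "\<lambda>y. kpair x y \<in> elts f"] by (simp add: app_def)
  then show "app f x \<in> B" using f unfolding is_map_def by fastforce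
qed

lemma category_closed:
  assumes "category T" "f \<in> elts (Mor T)"
  shows src_Obj: "src T f \<in> Obj T" and tgt_Obj: "tgt T f \<in> Obj T"
  using assms is_map_app by (fastforce simp: category_def Obj_def)+

text \<open>The negative of \<open>f\<close> is characterized without mentioning zero, as zero is the only idempotent
  element of a group.\<close>

lemma neg_eq_iff:
  assumes "additive_category T" "f \<in> elts (Mor T)"
  shows "neg T f = g \<longleftrightarrow> g \<in> Hom T (src T f) (tgt T f)
    \<and> add T (add T f g) (add T f g) = add T f g"
proof -
  let ?G = "Hom_group T (src T f) (tgt T f)"
  have "src T f \<in> Obj T" "tgt T f \<in> Obj T"
    using assms additive_category_imp_category category_closed by blast+
  then interpret comm_group ?G
    using assms(1) by (simp add: additive_category_def)
  have f: "f \<in> carrier ?G"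
    using assms(2) by (simp add: Hom_group_def Hom_def)
  have "inv\<^bsub>?G\<^esub> f = g \<longleftrightarrow> g \<in> carrier ?G \<and> (f \<otimes>\<^bsub>?G\<^esub> g) \<otimes>\<^bsub>?G\<^esub> (f \<otimes>\<^bsub>?G\<^esub> g) = f \<otimes>\<^bsub>?G\<^esub> g"
    using f by (metis inv_closed inv_equality m_closed m_comm l_cancel_one' r_inv r_one one_closed)
  then show ?thesis
    by (simp add: neg_def Hom_group_def)
qed

text \<open>Formula for the axioms that an additive category satisfies in addition to those of a category.\<close>

definition additive_fm :: "('c, 'm) add_cat_scheme \<Rightarrow> 'c fm" where
  "additive_fm T =
    (binary_map_fm (Add T) (Mor T) (Mor T) (\<lambda>f g. srcT T f \<^bold>= srcT T g \<^bold>\<and> tgtT T f \<^bold>= tgtT T g)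
     \<^bold>\<and> AllObj T 0 (AllObj T 1 (
          AllHom T 2 (Var 0) (Var 1) (AllHom T 3 (Var 0) (Var 1) (
            Hom_fm T (addT T (Var 2) (Var 3)) (Var 0) (Var 1)
            \<^bold>\<and> addT T (Var 2) (Var 3) \<^bold>= addT T (Var 3) (Var 2)
            \<^bold>\<and> AllHom T 4 (Var 0) (Var 1) (
                 addT T (addT T (Var 2) (Var 3)) (Var 4) \<^bold>= addT T (Var 2) (addT T (Var 3) (Var 4)))))
          \<^bold>\<and> ExHom T 2 (Var 0) (Var 1) (AllHom T 3 (Var 0) (Var 1) (
               addT T (Var 2) (Var 3) \<^bold>= Var 3
               \<^bold>\<and> ExHom T 4 (Var 0) (Var 1) (addT T (Var 3) (Var 4) \<^bold>= Var 2)))))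
     \<^bold>\<and> AllObj T 0 (AllObj T 1 (AllObj T 2 (
          AllHom T 3 (Var 0) (Var 1) (AllHom T 4 (Var 0) (Var 1) (
          AllHom T 5 (Var 1) (Var 2) (AllHom T 6 (Var 1) (Var 2) (
            cmpT T (Var 5) (addT T (Var 3) (Var 4))
              \<^bold>= addT T (cmpT T (Var 5) (Var 3)) (cmpT T (Var 5) (Var 4))
            \<^bold>\<and> cmpT T (addT T (Var 5) (Var 6)) (Var 3)
              \<^bold>= addT T (cmpT T (Var 5) (Var 3)) (cmpT T (Var 6) (Var 3)))))))))
     \<^bold>\<and> BEx 0 (MorT T) (zero_object_fm T 0)
     \<^bold>\<and> AllObj T 0 (AllObj T 1 (ExObj T 2 (
          ExHom T 3 (Var 0) (Var 2) (ExHom T 4 (Var 1) (Var 2) (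
          ExHom T 5 (Var 2) (Var 0) (ExHom T 6 (Var 2) (Var 1) (
            cmpT T (Var 5) (Var 3) \<^bold>= Var 0 \<^bold>\<and> cmpT T (Var 6) (Var 4) \<^bold>= Var 1
            \<^bold>\<and> addT T (cmpT T (Var 3) (Var 5)) (cmpT T (Var 4) (Var 6)) \<^bold>= Var 2))))))))"

lemma sat_additive_fm:
  "additive_category T \<longleftrightarrow> category T \<and> is_set (Add T) \<and> sat e (additive_fm T)"
proof -
  have 1: "is_map f {kpair x y |x y. x \<in> elts A \<and> y \<in> elts A \<and> src T x = src T y \<and> tgt T x = tgt T y} (elts B)
     \<longleftrightarrow> is_set f \<and> sat e (binary_map_fm f A B (\<lambda>f g. srcT T f \<^bold>= srcT T g \<^bold>\<and> tgtT T f \<^bold>= tgtT T g))" for f A B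
    by (rule sat_binary_map_fm) simp
  have 2: "(\<exists>z. zero_object T z) \<longleftrightarrow> (\<exists>z\<in>elts (Mor T). zero_object T z)"
    by (auto simp: zero_object_def Obj_def)
  show ?thesis
    unfolding additive_category_def additive_fm_def 1 2 comm_group_Hom_group_iff
    by simp
qed

text \<open>Formula saying that \<open>F\<close> is an additive functor, given that \<open>T\<close> and \<open>T'\<close> are additive categories.\<close>

definition functor_fm :: "('c, 'm) add_cat_scheme \<Rightarrow> ('c, 'n) add_cat_scheme \<Rightarrow> 'c \<Rightarrow> 'c fm" where
  "functor_fm T T' F =
    (unary_map_fm F (Mor T) (Mor T') (\<lambda>x. x \<^bold>= x)
     \<^bold>\<and> BAll 0 (MorT T) (AppT (Const F) (srcT T (Var 0)) \<^bold>= srcT T' (AppT (Const F) (Var 0))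
          \<^bold>\<and> AppT (Const F) (tgtT T (Var 0)) \<^bold>= tgtT T' (AppT (Const F) (Var 0)))
     \<^bold>\<and> BAlls [1, 0] (MorT T) (srcT T (Var 1) \<^bold>= tgtT T (Var 0) \<^bold>\<longrightarrow>
          AppT (Const F) (cmpT T (Var 1) (Var 0))
            \<^bold>= cmpT T' (AppT (Const F) (Var 1)) (AppT (Const F) (Var 0)))
     \<^bold>\<and> AllObj T 0 (AllObj T 1 (AllHom T 2 (Var 0) (Var 1) (AllHom T 3 (Var 0) (Var 1) (
          AppT (Const F) (addT T (Var 2) (Var 3))
            \<^bold>= addT T' (AppT (Const F) (Var 2)) (AppT (Const F) (Var 3)))))))"

lemma sat_functor_fm:
  "additive_functor T T' F \<longleftrightarrow> additive_category T \<and> additive_category T' \<and> is_set F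
     \<and> sat e (functor_fm T T' F)"
proof -
  have 1: "is_map f (elts A) (elts B) \<longleftrightarrow> is_set f \<and> sat e (unary_map_fm f A B (\<lambda>x. x \<^bold>= x))" for f A B
    using sat_unary_map_fm[of "\<lambda>x. x \<^bold>= x" "\<lambda>x. True"] by simp
  show ?thesis
    unfolding additive_functor_def is_functor_def functor_fm_def 1
    by (simp, intro impI iffI conjI; (elim conjE)?; (assumption | erule additive_category_imp_category)?)
qed

section \<open>Triangulated categories\<close>

definition triangle_fm :: "('c, 'm) tri_cat_scheme \<Rightarrow> 'c trm \<Rightarrow> 'c trm \<Rightarrow> 'c trm \<Rightarrow> 'c fm" where
  "triangle_fm T u v w = (u \<^bold>\<in> MorT T \<^bold>\<and> v \<^bold>\<in> MorT T \<^bold>\<and> w \<^bold>\<in> MorT T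
     \<^bold>\<and> srcT T v \<^bold>= tgtT T u \<^bold>\<and> srcT T w \<^bold>= tgtT T v \<^bold>\<and> tgtT T w \<^bold>= shiftT T (srcT T u))"

definition distinguished_fm :: "('c, 'm) tri_cat_scheme \<Rightarrow> 'c trm \<Rightarrow> 'c trm \<Rightarrow> 'c trm \<Rightarrow> 'c fm" where
  "distinguished_fm T u v w = (tripT u v w \<^bold>\<in> Const (Tri T))"

definition triangle_morphism_fm :: "('c, 'm) tri_cat_scheme
    \<Rightarrow> 'c trm \<Rightarrow> 'c trm \<Rightarrow> 'c trm \<Rightarrow> 'c trm \<Rightarrow> 'c trm \<Rightarrow> 'c trm \<Rightarrow> 'c trm \<Rightarrow> 'c trm \<Rightarrow> 'c trm \<Rightarrow> 'c fm" where
  "triangle_morphism_fm T u v w u' v' w' f g h =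
     (Hom_fm T f (srcT T u) (srcT T u') \<^bold>\<and> Hom_fm T g (tgtT T u) (tgtT T u')
     \<^bold>\<and> Hom_fm T h (tgtT T v) (tgtT T v')
     \<^bold>\<and> cmpT T g u \<^bold>= cmpT T u' f \<^bold>\<and> cmpT T h v \<^bold>= cmpT T v' g \<^bold>\<and> cmpT T (shiftT T f) w \<^bold>= cmpT T w' h)"

lemma sat_triangle_fms [simp]:
  "sat e (triangle_fm T u v w) \<longleftrightarrow> triangle T (val e u) (val e v) (val e w)"
  "sat e (distinguished_fm T u v w) \<longleftrightarrow> distinguished T (val e u) (val e v) (val e w)"
  "sat e (triangle_morphism_fm T u v w u' v' w' f g h) \<longleftrightarrow>
    triangle_morphism T (val e u) (val e v) (val e w) (val e u') (val e v') (val e w')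
      (val e f) (val e g) (val e h)"
  by (simp_all add: triangle_fm_def triangle_def distinguished_fm_def distinguished_def triple_def
      triangle_morphism_fm_def triangle_morphism_def)

text \<open>Every element of \<open>Tri\<close> is a triangle.\<close>

definition Tri_fm :: "('c, 'm) tri_cat_scheme \<Rightarrow> 'c fm" where
  "Tri_fm T = BAll 0 (Const (Tri T)) (BEx 1 (MorT T) (BEx 2 (MorT T) (BEx 3 (MorT T)
     (Var 0 \<^bold>= tripT (Var 1) (Var 2) (Var 3) \<^bold>\<and> triangle_fm T (Var 1) (Var 2) (Var 3)))))"

text \<open>Formulas for the axioms of triangulated categories, with all quantifiers bounded by the set of
  morphisms.\<close>

definition TR1_fm :: "('c, 'm) tri_cat_scheme \<Rightarrow> 'c fm" where
  "TR1_fm T =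
    (BAlls [0, 1, 2, 3, 4, 5, 6, 7, 8] (MorT T) (
       distinguished_fm T (Var 0) (Var 1) (Var 2) \<^bold>\<and> triangle_fm T (Var 3) (Var 4) (Var 5)
       \<^bold>\<and> triangle_morphism_fm T (Var 0) (Var 1) (Var 2) (Var 3) (Var 4) (Var 5) (Var 6) (Var 7) (Var 8)
       \<^bold>\<and> is_iso_fm T (Var 6) \<^bold>\<and> is_iso_fm T (Var 7) \<^bold>\<and> is_iso_fm T (Var 8)
       \<^bold>\<longrightarrow> distinguished_fm T (Var 3) (Var 4) (Var 5))
     \<^bold>\<and> BAlls [0, 1] (MorT T) (Obj_fm T (Var 0) \<^bold>\<and> zero_object_fm T 1 \<^bold>\<longrightarrow>
         AllHom T 2 (Var 0) (Var 1) (AllHom T 3 (Var 1) (shiftT T (Var 0))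
           (distinguished_fm T (Var 0) (Var 2) (Var 3))))
     \<^bold>\<and> BAll 0 (MorT T) (BEx 1 (MorT T) (BEx 2 (MorT T) (distinguished_fm T (Var 0) (Var 1) (Var 2)))))"

text \<open>The variable \<open>3\<close> stands for \<open>-\<Sigma>u\<close>.\<close>

definition TR2_fm :: "('c, 'm) tri_cat_scheme \<Rightarrow> 'c fm" where
  "TR2_fm T = BAlls [0, 1, 2] (MorT T) (triangle_fm T (Var 0) (Var 1) (Var 2) \<^bold>\<longrightarrow>
     (distinguished_fm T (Var 0) (Var 1) (Var 2) \<^bold>\<longleftrightarrow>
       ExHom T 3 (srcT T (shiftT T (Var 0))) (tgtT T (shiftT T (Var 0)))
         (addT T (addT T (shiftT T (Var 0)) (Var 3)) (addT T (shiftT T (Var 0)) (Var 3))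
            \<^bold>= addT T (shiftT T (Var 0)) (Var 3)
          \<^bold>\<and> distinguished_fm T (Var 1) (Var 2) (Var 3))))"

definition TR3_fm :: "('c, 'm) tri_cat_scheme \<Rightarrow> 'c fm" where
  "TR3_fm T = BAlls [0, 1, 2, 3, 4, 5, 6, 7] (MorT T) (
       distinguished_fm T (Var 0) (Var 1) (Var 2) \<^bold>\<and> distinguished_fm T (Var 3) (Var 4) (Var 5)
       \<^bold>\<and> Hom_fm T (Var 6) (srcT T (Var 0)) (srcT T (Var 3))
       \<^bold>\<and> Hom_fm T (Var 7) (tgtT T (Var 0)) (tgtT T (Var 3))
       \<^bold>\<and> cmpT T (Var 7) (Var 0) \<^bold>= cmpT T (Var 3) (Var 6)
       \<^bold>\<longrightarrow> BEx 8 (MorT T) (triangle_morphism_fm T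
             (Var 0) (Var 1) (Var 2) (Var 3) (Var 4) (Var 5) (Var 6) (Var 7) (Var 8)))"

text \<open>The variables \<open>0\<close> to \<open>7\<close> stand for \<open>u\<close>, \<open>v\<close>, \<open>j\<close>, \<open>k\<close>, \<open>l\<close>, \<open>i\<close>, \<open>m\<close> and \<open>n\<close> of the octahedral axiom.\<close>

definition TR4_fm :: "('c, 'm) tri_cat_scheme \<Rightarrow> 'c fm" where
  "TR4_fm T = BAlls [0, 1, 2, 3, 4, 5, 6, 7] (MorT T) (
       srcT T (Var 1) \<^bold>= tgtT T (Var 0)
       \<^bold>\<and> distinguished_fm T (Var 0) (Var 2) (Var 3) \<^bold>\<and> distinguished_fm T (Var 1) (Var 4) (Var 5)
       \<^bold>\<and> distinguished_fm T (cmpT T (Var 1) (Var 0)) (Var 6) (Var 7)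
       \<^bold>\<longrightarrow> ExHom T 8 (tgtT T (Var 2)) (tgtT T (Var 6)) (ExHom T 9 (tgtT T (Var 6)) (tgtT T (Var 4)) (
             distinguished_fm T (Var 8) (Var 9) (cmpT T (shiftT T (Var 2)) (Var 5))
             \<^bold>\<and> cmpT T (Var 8) (Var 2) \<^bold>= cmpT T (Var 6) (Var 1)
             \<^bold>\<and> cmpT T (Var 7) (Var 8) \<^bold>= Var 3
             \<^bold>\<and> cmpT T (Var 9) (Var 6) \<^bold>= Var 4
             \<^bold>\<and> cmpT T (Var 5) (Var 9) \<^bold>= cmpT T (shiftT T (Var 0)) (Var 7))))"

lemma triangle_if_distinguished:
  assumes "\<forall>p\<in>elts (Tri T). \<exists>u v w. p = triple u v w \<and> triangle T u v w" "distinguished T u v w"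
  shows "triangle T u v w"
  using assms unfolding distinguished_def by fastforce

lemma Hom_in_Mor: "f \<in> Hom T x y \<Longrightarrow> f \<in> elts (Mor T)"
  by (simp add: Hom_def)

lemma sat_Tri_fm:
  "sat e (Tri_fm T) \<longleftrightarrow> (\<forall>p\<in>elts (Tri T). \<exists>u v w. p = triple u v w \<and> triangle T u v w)"
proof -
  have "sat e (Tri_fm T) \<longleftrightarrow> (\<forall>p\<in>elts (Tri T). \<exists>u\<in>elts (Mor T). \<exists>v\<in>elts (Mor T). \<exists>w\<in>elts (Mor T).
      p = triple u v w \<and> triangle T u v w)"
    by (simp add: Tri_fm_def triple_def)
  then show ?thesis by (simp add: triangle_def) meson
qed

lemma bounded_all8:
  assumes "\<And>a b c d e f g h. P a b c d e f g h
    \<Longrightarrow> a \<in> M \<and> b \<in> M \<and> c \<in> M \<and> d \<in> M \<and> e \<in> M \<and> f \<in> M \<and> g \<in> M \<and> h \<in> M"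
  shows "(\<forall>a\<in>M. \<forall>b\<in>M. \<forall>c\<in>M. \<forall>d\<in>M. \<forall>e\<in>M. \<forall>f\<in>M. \<forall>g\<in>M. \<forall>h\<in>M.
      P a b c d e f g h \<longrightarrow> Q a b c d e f g h)
    \<longleftrightarrow> (\<forall>a b c d e f g h. P a b c d e f g h \<longrightarrow> Q a b c d e f g h)"
  using assms by blast

lemma
  assumes Tri: "\<forall>p\<in>elts (Tri T). \<exists>u v w. p = triple u v w \<and> triangle T u v w"
  shows sat_TR1_fm: "sat e (TR1_fm T) \<longleftrightarrow> TR1 T"
    and sat_TR3_fm: "sat e (TR3_fm T) \<longleftrightarrow> TR3 T"
    and sat_TR4_fm: "sat e (TR4_fm T) \<longleftrightarrow> TR4 T"
proof -
  let ?M = "elts (Mor T)"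
  have dist: "u \<in> ?M \<and> v \<in> ?M \<and> w \<in> ?M" if "distinguished T u v w" for u v w
    using triangle_if_distinguished[OF Tri that] by (simp add: triangle_def)
  have tri: "u \<in> ?M \<and> v \<in> ?M \<and> w \<in> ?M" if "triangle T u v w" for u v w
    using that by (simp add: triangle_def)
  have iso: "f \<in> ?M" if "is_iso T f" for f
    using that by (simp add: is_iso_def)
  show "sat e (TR1_fm T) \<longleftrightarrow> TR1 T"
  proof -
    have "(\<forall>u\<in>?M. \<forall>v\<in>?M. \<forall>w\<in>?M. \<forall>u'\<in>?M. \<forall>v'\<in>?M. \<forall>w'\<in>?M. \<forall>f\<in>?M. \<forall>g\<in>?M. \<forall>h\<in>?M.
          distinguished T u v w \<and> triangle T u' v' w'
        \<and> triangle_morphism T u v w u' v' w' f g h \<and> is_iso T f \<and> is_iso T g \<and> is_iso T h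
        \<longrightarrow> distinguished T u' v' w')
      \<longleftrightarrow> (\<forall>u v w u' v' w' f g h. distinguished T u v w \<and> triangle T u' v' w'
        \<and> triangle_morphism T u v w u' v' w' f g h \<and> is_iso T f \<and> is_iso T g \<and> is_iso T h
        \<longrightarrow> distinguished T u' v' w')" (is "?A = ?A'")
      using dist tri iso by meson
    moreover have "(\<forall>x\<in>?M. \<forall>z\<in>?M. x \<in> Obj T \<and> zero_object T z
          \<longrightarrow> (\<forall>v\<in>Hom T x z. \<forall>w\<in>Hom T z (shift T x). distinguished T x v w))
      \<longleftrightarrow> (\<forall>x z. x \<in> Obj T \<and> zero_object T z
          \<longrightarrow> (\<forall>v\<in>Hom T x z. \<forall>w\<in>Hom T z (shift T x). distinguished T x v w))" (is "?B = ?B'")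
      by (auto simp: Obj_def zero_object_def)
    moreover have "(\<forall>u\<in>?M. \<exists>v\<in>?M. \<exists>w\<in>?M. distinguished T u v w)
      \<longleftrightarrow> (\<forall>u\<in>?M. \<exists>v w. distinguished T u v w)" (is "?C = ?C'")
      using dist by meson
    moreover have "sat e (TR1_fm T) \<longleftrightarrow> ?A \<and> ?B \<and> ?C"
      by (simp add: TR1_fm_def)
    ultimately show ?thesis
      unfolding TR1_def by (simp only:)
  qed
  show "sat e (TR3_fm T) \<longleftrightarrow> TR3 T"
  proof -
    have "h \<in> ?M" if "triangle_morphism T u v w u' v' w' f g h" for u v w u' v' w' f g h
      using that by (simp add: triangle_morphism_def Hom_def)
    then have hom: "(\<exists>h\<in>?M. triangle_morphism T u v w u' v' w' f g h)
        \<longleftrightarrow> (\<exists>h. triangle_morphism T u v w u' v' w' f g h)" for u v w u' v' w' f g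
      by blast
    have "(\<forall>u\<in>?M. \<forall>v\<in>?M. \<forall>w\<in>?M. \<forall>u'\<in>?M. \<forall>v'\<in>?M. \<forall>w'\<in>?M. \<forall>f\<in>?M. \<forall>g\<in>?M.
        distinguished T u v w \<and> distinguished T u' v' w'
        \<and> f \<in> Hom T (src T u) (src T u') \<and> g \<in> Hom T (tgt T u) (tgt T u')
        \<and> cmp T g u = cmp T u' f
        \<longrightarrow> (\<exists>h\<in>?M. triangle_morphism T u v w u' v' w' f g h)) \<longleftrightarrow> TR3 T"
      unfolding TR3_def hom by (intro bounded_all8) (auto dest: dist Hom_in_Mor)
    then show ?thesis
      by (simp add: TR3_fm_def)
  qed
  show "sat e (TR4_fm T) \<longleftrightarrow> TR4 T"
  proof -
    have "(\<forall>u\<in>?M. \<forall>v\<in>?M. \<forall>j\<in>?M. \<forall>k\<in>?M. \<forall>l\<in>?M. \<forall>i\<in>?M. \<forall>m\<in>?M. \<forall>n\<in>?M. src T v = tgt T u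
        \<and> distinguished T u j k \<and> distinguished T v l i \<and> distinguished T (cmp T v u) m n
        \<longrightarrow> (\<exists>f\<in>Hom T (tgt T j) (tgt T m). \<exists>g\<in>Hom T (tgt T m) (tgt T l).
              distinguished T f g (cmp T (shift T j) i)
              \<and> cmp T f j = cmp T m v \<and> cmp T n f = k
              \<and> cmp T g m = l \<and> cmp T i g = cmp T (shift T u) n)) \<longleftrightarrow> TR4 T"
      unfolding TR4_def by (intro bounded_all8) (auto dest: dist)
    then show ?thesis
      by (simp add: TR4_fm_def)
  qed
qed

lemma sat_TR2_fm:
  assumes "additive_category T" "is_map (Shift T) (elts (Mor T)) (elts (Mor T))"
  shows "sat e (TR2_fm T) \<longleftrightarrow> TR2 T"
proof -
  have "(\<exists>n\<in>Hom T (src T (shift T u)) (tgt T (shift T u)).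
        add T (add T (shift T u) n) (add T (shift T u) n) = add T (shift T u) n \<and> distinguished T v w n)
      \<longleftrightarrow> distinguished T v w (neg T (shift T u))" if "u \<in> elts (Mor T)" for u v w
    using neg_eq_iff[OF assms(1) is_map_app[OF assms(2) that]] by metis
  then have "sat e (TR2_fm T) \<longleftrightarrow> (\<forall>u\<in>elts (Mor T). \<forall>v\<in>elts (Mor T). \<forall>w\<in>elts (Mor T).
      triangle T u v w \<longrightarrow> (distinguished T u v w \<longleftrightarrow> distinguished T v w (neg T (shift T u))))"
    by (simp add: TR2_fm_def)
  then show ?thesis
    unfolding TR2_def by (auto simp: triangle_def)
qed

text \<open>The shift functor is bijective on morphisms.\<close>

definition bijective_fm :: "('c, 'm) tri_cat_scheme \<Rightarrow> 'c fm" where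
  "bijective_fm T =
    (BAlls [0, 1] (MorT T) (shiftT T (Var 0) \<^bold>= shiftT T (Var 1) \<^bold>\<longrightarrow> Var 0 \<^bold>= Var 1)
     \<^bold>\<and> BAll 0 (MorT T) (BEx 1 (MorT T) (shiftT T (Var 1) \<^bold>= Var 0)))"

lemma sat_bijective_fm:
  assumes "is_map (Shift T) (elts (Mor T)) (elts (Mor T))"
  shows "sat e (bijective_fm T) \<longleftrightarrow> bij_betw (app (Shift T)) (elts (Mor T)) (elts (Mor T))"
  using is_map_app[OF assms] by (fastforce simp: bijective_fm_def bij_betw_def inj_on_def image_def)

text \<open>Formula for the axioms of a triangulated category, up to the requirement that the components be
  sets.\<close>

definition triangulated_fm :: "('c, 'm) tri_cat_scheme \<Rightarrow> 'c fm" where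
  "triangulated_fm T = (category_fm T \<^bold>\<and> additive_fm T \<^bold>\<and> functor_fm T T (Shift T) \<^bold>\<and> bijective_fm T
     \<^bold>\<and> Tri_fm T \<^bold>\<and> TR1_fm T \<^bold>\<and> TR2_fm T \<^bold>\<and> TR3_fm T \<^bold>\<and> TR4_fm T)"

text \<open>The constants of the formulas about \<open>T\<close>.\<close>

definition components :: "('c, 'm) tri_cat_scheme \<Rightarrow> 'c set" where
  "components T = {Mor T, Src T, Tgt T, Comp T, Add T, Shift T, Tri T}"

lemma sat_triangulated_fm:
  "triangulated_category T \<longleftrightarrow> (\<forall>c\<in>components T. is_set c) \<and> sat e (triangulated_fm T)"
proof -
  have "is_map (Shift T) (elts (Mor T)) (elts (Mor T))" if "additive_functor T T (Shift T)"
    using that by (simp add: additive_functor_def is_functor_def)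
  then have "triangulated_category T \<longleftrightarrow> additive_category T \<and> additive_functor T T (Shift T)
      \<and> sat e (bijective_fm T) \<and> is_set (Tri T) \<and> sat e (Tri_fm T)
      \<and> sat e (TR1_fm T) \<and> sat e (TR2_fm T) \<and> sat e (TR3_fm T) \<and> sat e (TR4_fm T)"
    unfolding triangulated_category_def automorphism_def sat_Tri_fm
    by (auto simp: sat_bijective_fm sat_TR1_fm sat_TR2_fm sat_TR3_fm sat_TR4_fm)
  then show ?thesis
    unfolding sat_functor_fm[of _ _ _ e] sat_additive_fm[of _ e] sat_category_fm[of _ e]
      triangulated_fm_def components_def by auto
qed

text \<open>Formula saying that \<open>\<theta>\<close> is a natural isomorphism from \<open>F\<Sigma>\<close> to \<open>\<Sigma>'F\<close> by means of which \<open>F\<close> sends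
  distinguished triangles to distinguished triangles.\<close>

definition compatible_fm ::
  "('c, 'm) tri_cat_scheme \<Rightarrow> ('c, 'n) tri_cat_scheme \<Rightarrow> 'c \<Rightarrow> 'c \<Rightarrow> 'c fm" where
  "compatible_fm T T' F \<theta> =
    (unary_map_fm \<theta> (Mor T) (Mor T') (\<lambda>x. srcT T x \<^bold>= x)
     \<^bold>\<and> AllObj T 0 (
          Hom_fm T' (AppT (Const \<theta>) (Var 0)) (AppT (Const F) (shiftT T (Var 0)))
            (shiftT T' (AppT (Const F) (Var 0)))
          \<^bold>\<and> is_iso_fm T' (AppT (Const \<theta>) (Var 0)))
     \<^bold>\<and> BAll 0 (MorT T) (
          cmpT T' (AppT (Const \<theta>) (tgtT T (Var 0))) (AppT (Const F) (shiftT T (Var 0)))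
            \<^bold>= cmpT T' (shiftT T' (AppT (Const F) (Var 0))) (AppT (Const \<theta>) (srcT T (Var 0))))
     \<^bold>\<and> BAlls [0, 1, 2] (MorT T) (distinguished_fm T (Var 0) (Var 1) (Var 2) \<^bold>\<longrightarrow>
          distinguished_fm T' (AppT (Const F) (Var 0)) (AppT (Const F) (Var 1))
            (cmpT T' (AppT (Const \<theta>) (srcT T (Var 0))) (AppT (Const F) (Var 2)))))"

lemma sat_compatible_fm:
  assumes "triangulated_category T"
  shows "natural_iso T T' (\<lambda>f. app F (shift T f)) (\<lambda>f. shift T' (app F f)) \<theta>
      \<and> (\<forall>u v w. distinguished T u v w \<longrightarrow>
           distinguished T' (app F u) (app F v) (cmp T' (app \<theta> (src T u)) (app F w)))
    \<longleftrightarrow> is_set \<theta> \<and> sat e (compatible_fm T T' F \<theta>)"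
proof -
  have "u \<in> elts (Mor T) \<and> v \<in> elts (Mor T) \<and> w \<in> elts (Mor T)" if "distinguished T u v w" for u v w
    using assms triangle_if_distinguished[OF _ that] by (simp add: triangle_def triangulated_category_def)
  then have 1: "(\<forall>u v w. distinguished T u v w \<longrightarrow> P u v w)
      \<longleftrightarrow> (\<forall>u\<in>elts (Mor T). \<forall>v\<in>elts (Mor T). \<forall>w\<in>elts (Mor T). distinguished T u v w \<longrightarrow> P u v w)" for P
    by blast
  have 2: "is_map \<theta> (Obj T) (elts (Mor T'))
      \<longleftrightarrow> is_set \<theta> \<and> sat e (unary_map_fm \<theta> (Mor T) (Mor T') (\<lambda>x. srcT T x \<^bold>= x))"
    unfolding Obj_def by (rule sat_unary_map_fm) simp
  show ?thesis
    unfolding natural_iso_def 1 2 compatible_fm_def by simp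
qed

section \<open>Constants and free variables of the formulas\<close>

lemmas fm_defs = Imp_def Iff_def BEx_def Obj_fm_def Hom_fm_def AllObj_def ExObj_def AllHom_def ExHom_def
  unary_map_fm_def binary_map_fm_def category_fm_def zero_object_fm_def is_iso_fm_def additive_fm_def functor_fm_def
  triangle_fm_def distinguished_fm_def triangle_morphism_fm_def Tri_fm_def TR1_fm_def TR2_fm_def TR3_fm_def
  TR4_fm_def bijective_fm_def triangulated_fm_def compatible_fm_def

lemma closed_fms:
  "fv (functor_fm T T' F) = {}"
  "fv (triangulated_fm T) = {}"
  "fv (compatible_fm T T' F \<theta>) = {}"
  by (simp_all add: fm_defs insert_Diff_if)

lemma constants_fms:
  "set_fm (functor_fm T T' F) \<subseteq> {F} \<union> components T \<union> components T'"
  "set_fm (triangulated_fm T) \<subseteq> components T"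
  "set_fm (compatible_fm T T' F \<theta>) \<subseteq> {F, \<theta>} \<union> components T \<union> components T'"
  by (simp_all add: fm_defs components_def)

lemma map_fms:
  "map_fm star (functor_fm T T' F) = functor_fm (enlarge star T) (enlarge star T') (star F)"
  "map_fm star (triangulated_fm T) = triangulated_fm (enlarge star T)"
  "map_fm star (compatible_fm T T' F \<theta>) = compatible_fm (enlarge star T) (enlarge star T') (star F) (star \<theta>)"
  by (simp_all add: fm_defs enlarge_def)

section \<open>Enlargements of triangulated functors\<close>

lemma triangulated_components_in_hat:
  assumes "triangulated_category T" "elts (Mor T) \<subseteq> level S n"
  shows "components T \<subseteq> hat S"
proof -
  let ?M = "elts (Mor T)"
  have add: "additive_category T" and "additive_functor T T (Shift T)"
    using assms(1) by (simp_all add: triangulated_category_def automorphism_def)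
  then have shift: "is_map (Shift T) ?M ?M"
    by (simp add: additive_functor_def is_functor_def)
  have cat: "category T"
    using add by (rule additive_category_imp_category)
  have pairs: "{kpair x y |x y. x \<in> ?M \<and> y \<in> ?M \<and> P x y} \<subseteq> level S (Suc (Suc n))" for P
    using assms(2) kpair_level by blast
  have M: "?M \<subseteq> level S (Suc (Suc n))"
    using assms(2) level_mono[of n "Suc (Suc n)" S] by auto
  have "Src T \<in> hat S" "Tgt T \<in> hat S" "Shift T \<in> hat S"
    using cat shift map_in_hat[OF _ assms(2) assms(2)] by (simp_all add: category_def)
  moreover have "Comp T \<in> hat S"
    using cat unfolding category_def by (elim conjE) (rule map_in_hat[OF _ pairs M])
  moreover have "Add T \<in> hat S"
    using add unfolding additive_category_def by (elim conjE) (rule map_in_hat[OF _ pairs M])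
  moreover have "Mor T \<in> hat S"
    using cat assms(2) by (intro is_set_level) (auto simp: category_def)
  moreover have "Tri T \<in> hat S"
  proof (rule is_set_level)
    show "is_set (Tri T)" using assms(1) by (simp add: triangulated_category_def)
    show "elts (Tri T) \<subseteq> level S (Suc (Suc (Suc (Suc n))))"
    proof
      fix p assume "p \<in> elts (Tri T)"
      then obtain u v w where "p = triple u v w" "u \<in> ?M" "v \<in> ?M" "w \<in> ?M"
        using assms(1) unfolding triangulated_category_def triangle_def by blast
      then show "p \<in> level S (Suc (Suc (Suc (Suc n))))"
        unfolding triple_def using assms(2) M by (blast intro: kpair_level)
    qed
  qed
  ultimately show ?thesis
    by (simp add: components_def)
qed

lemma triangulated_enlarge:
  assumes "enlargement S W star" "triangulated_category T" "components T \<subseteq> hat S"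
  shows "triangulated_category (enlarge star T)"
proof -
  have "components (enlarge star T) = star ` components T"
    by (simp add: components_def enlarge_def)
  moreover have "is_set (star c)" if "c \<in> components T" for c
    using is_set_star[OF assms(1)] assms(2,3) that unfolding sat_triangulated_fm[of T undefined]
    by blast
  moreover have "sat e (map_fm star (triangulated_fm T))" for e
  proof (rule transfer[OF assms(1)])
    show "set_fm (triangulated_fm T) \<subseteq> hat S"
      using constants_fms(2)[of T] assms(3) by (rule subset_trans)
    show "sat e (triangulated_fm T)" for e
      using assms(2) by (simp add: sat_triangulated_fm[of T e])
  qed (rule closed_fms)
  ultimately show ?thesis
    unfolding sat_triangulated_fm[of _ undefined] by (simp add: map_fms)
qed

theorem proposition6p2:
  fixes S :: "'u::set_universe"
    and star :: "'u \<Rightarrow> 'u"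
    and T T' :: "'u tri_cat"
    and F :: 'u
  assumes "enlargement S (star S) star"
    and "small_triangulated_category S T"
    and "small_triangulated_category S T'"
    and "triangulated_functor T T' F"
  shows "triangulated_functor (enlarge star T) (enlarge star T') (star F)"
proof -
  let ?T = "enlarge star T" and ?T' = "enlarge star T'"
  have base: "base_set S"
    using assms(1) by (simp add: enlargement_def)
  have tri: "triangulated_category T" "triangulated_category T'"
    using assms(2,3) by (simp_all add: small_triangulated_category_def)
  obtain m m' where "Mor T \<in> level S m" "Mor T' \<in> level S m'"
    using assms(2,3) by (auto simp: small_triangulated_category_def hat_def)
  then obtain n where n: "elts (Mor T) \<subseteq> level S n" "elts (Mor T') \<subseteq> level S n"
    using elts_level[OF base] level_mono[of m "max m m'" S] level_mono[of m' "max m m'" S]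
    by (meson max.cobounded1 max.cobounded2 subset_trans)
  have comps: "components T \<union> components T' \<subseteq> hat S"
    using tri n triangulated_components_in_hat by blast
  have F: "additive_functor T T' F"
    using assms(4) by (simp add: triangulated_functor_def)
  obtain \<theta> where \<theta>: "natural_iso T T' (\<lambda>f. app F (shift T f)) (\<lambda>f. shift T' (app F f)) \<theta>
      \<and> (\<forall>u v w. distinguished T u v w \<longrightarrow>
           distinguished T' (app F u) (app F v) (cmp T' (app \<theta> (src T u)) (app F w)))"
    using assms(4) unfolding triangulated_functor_def by blast
  have "is_map F (elts (Mor T)) (elts (Mor T'))"
    using F by (simp add: additive_functor_def is_functor_def)
  then have F_hat: "F \<in> hat S"
    using n by (rule map_in_hat)
  have "is_map \<theta> (Obj T) (elts (Mor T'))"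
    using \<theta> by (simp add: natural_iso_def)
  moreover have "Obj T \<subseteq> level S n"
    using n(1) by (auto simp: Obj_def)
  ultimately have \<theta>_hat: "\<theta> \<in> hat S"
    using n(2) by (rule map_in_hat)
  have star_tri: "triangulated_category ?T" "triangulated_category ?T'"
    using triangulated_enlarge[OF assms(1)] tri comps by simp_all
  have "sat e (map_fm star (functor_fm T T' F))" for e
  proof (rule transfer[OF assms(1)])
    show "set_fm (functor_fm T T' F) \<subseteq> hat S"
      using constants_fms(1)[of T T' F] comps F_hat by blast
    show "sat e (functor_fm T T' F)" for e
      using F by (simp add: sat_functor_fm[of T T' F e])
  qed (rule closed_fms)
  moreover have "is_set (star F)"
    using F F_hat is_set_star[OF assms(1)] by (simp add: sat_functor_fm[of T T' F undefined])
  ultimately have star_F: "additive_functor ?T ?T' (star F)"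
    using star_tri unfolding sat_functor_fm[of _ _ _ undefined]
    by (simp add: map_fms triangulated_category_def)
  have "sat e (map_fm star (compatible_fm T T' F \<theta>))" for e
  proof (rule transfer[OF assms(1)])
    show "set_fm (compatible_fm T T' F \<theta>) \<subseteq> hat S"
      using constants_fms(3)[of T T' F \<theta>] comps F_hat \<theta>_hat by blast
    show "sat e (compatible_fm T T' F \<theta>)" for e
      using \<theta> unfolding sat_compatible_fm[OF tri(1), of _ _ _ e] by (rule conjunct2)
  qed (rule closed_fms)
  moreover have "is_set (star \<theta>)"
    using \<theta> \<theta>_hat is_set_star[OF assms(1)]
    unfolding sat_compatible_fm[OF tri(1), of _ _ _ undefined] by blast
  ultimately show ?thesis
    using star_tri star_F sat_compatible_fm[OF star_tri(1), of ?T' "star F" "star \<theta>" undefined]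
    unfolding triangulated_functor_def map_fms by blast
qed

end
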